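(* Let $r,s\ge1$, let $(k_i)_{i=1}^r$ and $(l_i)_{i=1}^s$ be sequences of natural numbers, and let $(\alpha_i)_{i=1}^r$ and $(\beta_i)_{i=1}^s$ be sequences in $\Omega$. Then (i) $\sum_{i=1}^r\phi_{k_i}(\alpha_i)\neq0$; and (ii) if $\sum_{i=1}^r\phi_{k_i}(\alpha_i)=\sum_{i=1}^s\phi_{l_i}(\beta_i)$, then $r=s$ and $k_i=l_i$, $\alpha_i=\beta_i$ for every $1\le i\le r$.
   Context: Constructive ordinals: $\Omega$ is the set of infinitary terms generated by $0$, successor $\alpha+1$, and limits $\langle\alpha_i\rangle_{i\in\mathbb{N}}$; equality is syntactic. $o(0)=0$, $o(n+1)=o(n)+1$, $\omega=\langle o(i+1)\rangle_i$. Arithmetic: $\alpha+0=\alpha$, $\alpha+(\beta+1)=(\alpha+\beta)+1$, $\alpha+\langle\beta_i\rangle=\langle\alpha+\beta_i\rangle$ (this addition is associative, so $\sum_{i=1}^r$ is unambiguous); $\alpha\cdot0=0$, $\alpha\cdot(\beta+1)=\alpha\cdot\beta+\alpha$, $\alpha\cdot\langle\beta_i\rangle=\langle\alpha\cdot\beta_i\rangle$; $\alpha^0=o(1)$, $\alpha^{\beta+1}=\alpha^\beta\cdot\alpha$, $\alpha^{\langle\beta_i\rangle}=\langle\alpha^{\beta_i}\rangle$. Constructive Veblen functions: $\phi_0(\gamma)=\omega^\gamma$; $\phi_{k+1}(0)=\langle\phi_k^{(i)}(0)\rangle_i$; $\phi_{k+1}(\gamma+1)=\langle\phi_k^{(i)}(\phi_{k+1}(\gamma)+1)\rangle_i$;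 $\phi_{k+1}(\langle\gamma_i\rangle)=\langle\phi_{k+1}(\gamma_i)\rangle_i$. *)

theory Defs
  imports Main
begin

datatype cord = Zero | Succ cord | Lim "nat \<Rightarrow> cord"

instantiation cord :: "{zero, plus, times}"
begin

definition zero_cord :: cord where
  "0 = Zero"

primrec plus_cord :: "cord \<Rightarrow> cord \<Rightarrow> cord" where
  "\<alpha> + Zero = \<alpha>"
| "\<alpha> + Succ \<beta> = Succ (\<alpha> + \<beta>)"
| "\<alpha> + Lim \<beta> = Lim (\<lambda>i. \<alpha> + \<beta> i)"

primrec times_cord :: "cord \<Rightarrow> cord \<Rightarrow> cord" where
  "\<alpha> * Zero = Zero"
| "\<alpha> * Succ \<beta> = \<alpha> * \<beta> + \<alpha>"
| "\<alpha> * Lim \<beta> = Lim (\<lambda>i. \<alpha> * \<beta> i)"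

instance ..

end

instance cord :: monoid_add
proof
  fix a b c :: cord
  show "a + b + c = a + (b + c)"
    by (induction c) simp_all
  show "0 + a = a"
    unfolding zero_cord_def by (induction a) simp_all
  show "a + 0 = a"
    unfolding zero_cord_def by simp
qed

primrec fin_cord :: "nat \<Rightarrow> cord" where
  "fin_cord 0 = Zero"
| "fin_cord (Suc n) = Succ (fin_cord n)"

definition omega :: cord where
  "omega = Lim (\<lambda>i. fin_cord (i + 1))"

primrec cpow :: "cord \<Rightarrow> cord \<Rightarrow> cord" where
  "cpow \<alpha> Zero = fin_cord 1"
| "cpow \<alpha> (Succ \<beta>) = cpow \<alpha> \<beta> * \<alpha>"
| "cpow \<alpha> (Lim \<beta>) = Lim (\<lambda>i. cpow \<alpha> (\<beta> i))"

text \<open>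
  The passage from \<open>\<phi>\<^sub>k\<close> to \<open>\<phi>\<^sub>k\<^sub>+\<^sub>1\<close>, split off so that both recursions are primitive; the
  iteration \<open>f ^^ i\<close> starts with the identity at \<open>i = 0\<close>.
\<close>

primrec veblen_step :: "(cord \<Rightarrow> cord) \<Rightarrow> cord \<Rightarrow> cord" where
  "veblen_step f Zero = Lim (\<lambda>i. (f ^^ i) Zero)"
| "veblen_step f (Succ \<gamma>) = Lim (\<lambda>i. (f ^^ i) (Succ (veblen_step f \<gamma>)))"
| "veblen_step f (Lim \<gamma>) = Lim (\<lambda>i. veblen_step f (\<gamma> i))"

primrec veblen :: "nat \<Rightarrow> cord \<Rightarrow> cord" where
  "veblen 0 = cpow omega"
| "veblen (Suc k) = veblen_step (veblen k)"

end

theory Submission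
  imports Defs
begin

text \<open>
  Every summand \<open>\<phi>\<^sub>k(\<alpha>)\<close> other than \<open>\<phi>\<^sub>0(0) = 1\<close> is a limit whose \<open>i\<close>-th member is again a finite
  sum of Veblen terms, and so is every sum ending in that summand. By induction on the common value,
  the decompositions of the members are unique, and the members with index 0, 1, 2 determine the
  last summand: its shape can be read off from the number of terms of these three decompositions.
\<close>

text \<open>Lists of arbitrary length, including the empty one, are needed because the member of
  \<open>veblen (Suc k) Zero\<close> at index 0 is \<open>Zero\<close>.\<close>

definition veblen_sum :: "(nat \<times> cord) list \<Rightarrow> cord" where
  "veblen_sum ps = (\<Sum>p\<leftarrow>ps. veblen (fst p) (snd p))"

text \<open>The first equation is a junk value, since \<open>\<phi>\<^sub>0(0)\<close> is not a limit.\<close>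

fun veblen_fund :: "nat \<Rightarrow> cord \<Rightarrow> nat \<Rightarrow> (nat \<times> cord) list" where
  "veblen_fund 0 Zero i = []"
| "veblen_fund 0 (Succ \<gamma>) i = replicate (Suc i) (0, \<gamma>)"
| "veblen_fund (Suc k) Zero 0 = []"
| "veblen_fund (Suc k) Zero (Suc i) = [(k, (veblen k ^^ i) Zero)]"
| "veblen_fund (Suc k) (Succ \<gamma>) 0 = [(Suc k, \<gamma>), (0, Zero)]"
| "veblen_fund (Suc k) (Succ \<gamma>) (Suc i) = [(k, (veblen k ^^ i) (Succ (veblen (Suc k) \<gamma>)))]"
| "veblen_fund k (Lim \<gamma>) i = [(k, \<gamma> i)]"

lemma veblen_sum_Nil [simp]: "veblen_sum [] = Zero"
  by (simp add: veblen_sum_def zero_cord_def)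

lemma veblen_sum_single [simp]: "veblen_sum [(k, \<alpha>)] = veblen k \<alpha>"
  by (simp add: veblen_sum_def)

lemma veblen_sum_append [simp]: "veblen_sum (ps @ qs) = veblen_sum ps + veblen_sum qs"
  by (simp add: veblen_sum_def)

lemma times_fin_cord: "veblen k \<alpha> * fin_cord n = veblen_sum (replicate n (k, \<alpha>))"
proof (induction n)
  case (Suc n)
  \<comment> \<open>\<open>replicate\<close> unfolds at the front, whereas multiplication by a
    successor adds the new copy on the right.\<close>
  have "replicate (Suc n) (k, \<alpha>) = replicate n (k, \<alpha>) @ [(k, \<alpha>)]"
    by (simp add: replicate_append_same)
  with Suc show ?case
    by (simp only: veblen_sum_append veblen_sum_single fin_cord.simps times_cord.simps)
qed simp

text \<open>An iterate at index \<open>Suc i\<close> is a single Veblen term applied to the iterate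
  at \<open>i\<close>; only the start value at index 0 has to be split separately. For
  \<open>k = 0\<close> and a successor \<open>Succ \<gamma>\<close>, the members are multiples of
  \<open>veblen 0 \<gamma>\<close>.\<close>

lemma veblen_eq_Lim:
  assumes "(k, \<alpha>) \<noteq> (0, Zero)"
  shows "veblen k \<alpha> = Lim (\<lambda>i. veblen_sum (veblen_fund k \<alpha> i))"
proof (cases \<alpha>)
  case Zero
  with assms obtain k' where "k = Suc k'" by (cases k) auto
  moreover have "(veblen k' ^^ i) Zero = veblen_sum (veblen_fund (Suc k') Zero i)" for i
    by (cases i) simp_all
  ultimately show ?thesis using Zero by simp
next
  case (Succ \<gamma>)
  show ?thesis
  proof (cases k)
    case 0
    then show ?thesis
      using Succ times_fin_cord[of 0 \<gamma> "Suc i" for i] by (simp add: omega_def)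
  next
    case (Suc k')
    \<comment> \<open>The start value of the iteration is a sum of two Veblen terms, since adding 1
      means adding \<open>veblen 0 Zero\<close>.\<close>
    have "veblen_sum [(Suc k', \<gamma>), (0, Zero)] = Succ (veblen (Suc k') \<gamma>)"
      using veblen_sum_append[of "[(Suc k', \<gamma>)]" "[(0, Zero)]"] by simp
    then have "(veblen k' ^^ i) (Succ (veblen (Suc k') \<gamma>))
        = veblen_sum (veblen_fund (Suc k') (Succ \<gamma>) i)" for i
      by (cases i) simp_all
    with Succ Suc show ?thesis by simp
  qed
next
  case (Lim \<gamma>)
  then show ?thesis by (cases k) simp_all
qed

text \<open>The prefixes do not depend on \<open>i\<close>, so they cancel in the changes of length
  between indices. Once the shapes agree, the appended lists have equal lengths, hence the prefixes
  coincide and the entries can be compared.\<close>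

lemma veblen_fund_inject:
  assumes eq: "\<And>i. ps @ veblen_fund k \<alpha> i = qs @ veblen_fund l \<beta> i"
    and "(k, \<alpha>) \<noteq> (0, Zero)" "(l, \<beta>) \<noteq> (0, Zero)"
  shows "ps = qs \<and> k = l \<and> \<alpha> = \<beta>"
proof -
  note e = eq[of 0] eq[of "Suc 0"] eq[of "Suc (Suc 0)"]
  \<comment> \<open>From index 0 to 1 and from 1 to 2 the length changes by +1, +1 for
    \<open>k = 0\<close> and a successor; for positive \<open>k\<close> by +1, 0 at zero and by -1,
    0 at a successor; by 0, 0 at a limit. These patterns are pairwise distinct.\<close>
  note len = e[THEN arg_cong[where f = length]]
  show ?thesis
  proof (cases \<alpha>; cases \<beta>)
    \<comment> \<open>Three indices do not suffice here: the sequences must be compared at every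
      index.\<close>
    fix \<gamma> \<delta> assume "\<alpha> = Lim \<gamma>" "\<beta> = Lim \<delta>"
    with eq show ?thesis by (auto intro: ext)
  qed (use assms(2,3) e len in \<open>cases k; cases l; auto\<close>)+
qed

text \<open>Addition recurses on its right argument, so the last term alone decides the outermost
  constructor of the sum.\<close>

lemma veblen_sum_snoc_cases:
  obtains "(k, \<alpha>) = (0, Zero)" "veblen_sum (ps @ [(k, \<alpha>)]) = Succ (veblen_sum ps)"
  | "(k, \<alpha>) \<noteq> (0, Zero)"
    "veblen_sum (ps @ [(k, \<alpha>)]) = Lim (\<lambda>i. veblen_sum (ps @ veblen_fund k \<alpha> i))"
proof (cases "(k, \<alpha>) = (0, Zero)")
  case True
  then show ?thesis using that(1) by simp
next
  case False
  then show ?thesis using that(2) veblen_eq_Lim[OF False] by simp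
qed

text \<open>The common value is named \<open>x\<close> to induct on it rather than on the lists,
  which can become longer when a limit is replaced by one of its members.\<close>

lemma veblen_sum_inject:
  "veblen_sum ps = x \<Longrightarrow> veblen_sum qs = x \<Longrightarrow> ps = qs"
proof (induction x arbitrary: ps qs)
  case Zero
  have "rs = []" if "veblen_sum rs = Zero" for rs
  proof (cases rs rule: rev_cases)
    case (snoc rs' p)
    obtain k \<alpha> where "p = (k, \<alpha>)" by fastforce
    with snoc that show ?thesis
      by (cases rule: veblen_sum_snoc_cases[of k \<alpha> rs']) (simp_all del: veblen_sum_append)
  qed
  with Zero show ?case by metis
next
  case (Succ x)
  have "\<exists>rs'. rs = rs' @ [(0, Zero)] \<and> veblen_sum rs' = x" if "veblen_sum rs = Succ x" for rs
  proof (cases rs rule: rev_cases)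
    case Nil
    with that show ?thesis by simp
  next
    case (snoc rs' p)
    obtain k \<alpha> where "p = (k, \<alpha>)" by fastforce
    with snoc that show ?thesis
      by (cases rule: veblen_sum_snoc_cases[of k \<alpha> rs']) (simp_all del: veblen_sum_append)
  qed
  with Succ show ?case by metis
next
  case (Lim f)
  have decomp: "\<exists>rs' k \<alpha>. rs = rs' @ [(k, \<alpha>)] \<and> (k, \<alpha>) \<noteq> (0, Zero)
      \<and> (\<forall>i. veblen_sum (rs' @ veblen_fund k \<alpha> i) = f i)" if "veblen_sum rs = Lim f" for rs
  proof (cases rs rule: rev_cases)
    case Nil
    with that show ?thesis by simp
  next
    case (snoc rs' p)
    obtain k \<alpha> where "p = (k, \<alpha>)" by fastforce
    with snoc that show ?thesis
      by (cases rule: veblen_sum_snoc_cases[of k \<alpha> rs'])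
        (auto simp del: veblen_sum_append)
  qed
  obtain ps' k \<alpha> where ps: "ps = ps' @ [(k, \<alpha>)]" "(k, \<alpha>) \<noteq> (0, Zero)"
    "\<And>i. veblen_sum (ps' @ veblen_fund k \<alpha> i) = f i"
    using decomp[OF Lim.prems(1)] by blast
  obtain qs' l \<beta> where qs: "qs = qs' @ [(l, \<beta>)]" "(l, \<beta>) \<noteq> (0, Zero)"
    "\<And>i. veblen_sum (qs' @ veblen_fund l \<beta> i) = f i"
    using decomp[OF Lim.prems(2)] by blast
  \<comment> \<open>Both lists sum to \<open>f i\<close>, a member of \<open>Lim f\<close>, so the
    induction hypothesis identifies them.\<close>
  have "ps' @ veblen_fund k \<alpha> i = qs' @ veblen_fund l \<beta> i" for i
    using Lim.IH[OF rangeI ps(3) qs(3)] .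
  from veblen_fund_inject[OF this ps(2) qs(2)] show ?case
    using ps(1) qs(1) by simp
qed

theorem theorem6p16:
  fixes r s :: nat
    and k l :: "nat \<Rightarrow> nat"
    and \<alpha> \<beta> :: "nat \<Rightarrow> cord"
  assumes "r \<ge> 1" and "s \<ge> 1"
  shows "(\<Sum>i\<leftarrow>[1..<Suc r]. veblen (k i) (\<alpha> i)) \<noteq> 0
    \<and> ((\<Sum>i\<leftarrow>[1..<Suc r]. veblen (k i) (\<alpha> i)) = (\<Sum>i\<leftarrow>[1..<Suc s]. veblen (l i) (\<beta> i))
        \<longrightarrow> r = s \<and> (\<forall>i\<in>{1..r}. k i = l i \<and> \<alpha> i = \<beta> i))"
proof -
  define terms where "terms k \<alpha> n = map (\<lambda>i. (k i, \<alpha> i)) [1..<Suc n]"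
    for k :: "nat \<Rightarrow> nat" and \<alpha> :: "nat \<Rightarrow> cord" and n
  have sum_eq: "(\<Sum>i\<leftarrow>[1..<Suc n]. veblen (k i) (\<alpha> i)) = veblen_sum (terms k \<alpha> n)" for k \<alpha> n
    by (simp add: veblen_sum_def terms_def comp_def del: upt_Suc)
  have length_terms: "length (terms k \<alpha> n) = n" for k \<alpha> n
    by (simp add: terms_def del: upt_Suc)
  \<comment> \<open>The empty list also sums to \<open>Zero\<close>, so by uniqueness a nonempty
    list cannot.\<close>
  have "veblen_sum (terms k \<alpha> r) \<noteq> 0"
    using veblen_sum_inject[of "terms k \<alpha> r" Zero "[]"] length_terms[of k \<alpha> r] assms(1)
    by (auto simp: zero_cord_def)
  moreover have "r = s \<and> (\<forall>i\<in>{1..r}. k i = l i \<and> \<alpha> i = \<beta> i)"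
    if "veblen_sum (terms k \<alpha> r) = veblen_sum (terms l \<beta> s)"
  proof -
    have eq: "terms k \<alpha> r = terms l \<beta> s"
      using veblen_sum_inject[OF that refl] .
    then have "r = s" by (metis length_terms)
    with eq show ?thesis
      by (simp add: terms_def atLeastLessThanSuc_atLeastAtMost del: upt_Suc)
  qed
  ultimately show ?thesis unfolding sum_eq by blast
qed

end
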